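(* Let $d\ge1$, let $\boldsymbol\rho\in B_d\setminus\{\boldsymbol 0\}$, and set \[ \nu_{\boldsymbol\rho}=\sum_{j=1}^d\frac{\rho_j}{R_{\boldsymbol\rho}}\,\delta_{e_j}, \] a finitely supported function on $\mathbb Z^d$. With $\nu_{\boldsymbol\rho}^{*0}=\delta_0$, we have \[ c_N(\boldsymbol\rho)=\|\nu_{\boldsymbol\rho}^{*N}\|_{\ell^2(\mathbb Z^d)},\qquad N\ge0. \] If at least two components of $\boldsymbol\rho$ are positive, then $c_N(\boldsymbol\rho)\to0$ as $N\to\infty$.
   Context: $B_d=\{\boldsymbol\rho=(\rho_1,\dots,\rho_d)\in[0,1]^d:\rho_1+\cdots+\rho_d\le1\}$ and $R_{\boldsymbol\rho}=\rho_1+\cdots+\rho_d$. For $\alpha\in\mathbb N_0^d$, $|\alpha|=\sum_j\alpha_j$, $\alpha!=\prod_j\alpha_j!$; $0^0=1$. For $N\in\mathbb N_0$, $h_N(\boldsymbol\rho)\ge0$ is defined by \[ h_N(\boldsymbol\rho)^2=\sum_{|\alpha|=N}\frac1{(\alpha!)^2}\prod_{j=1}^d\left(\frac{\rho_j}{2}\right)^{2\alpha_j}, \] and $c_N(\boldsymbol\rho)=\dfrac{h_N(\boldsymbol\rho)}{(R_{\boldsymbol\rho}/2)^N/N!}$. Here $e_1,\dots,e_d$ is the standard basis of $\mathbb Z^d$, $\delta_x$ is the point mass at $x\in\mathbb Z^d$ (the function equal to $1$ at $x$ and $0$ elsewhere), convolution on $\mathbb Z^d$ is $(f*g)(\alpha)=\sum_{\beta\in\mathbb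 Z^d}f(\beta)g(\alpha-\beta)$, and $\nu^{*N}$ is the $N$-fold convolution power. *)

theory Defs
  imports "HOL-Analysis.Analysis"
begin

text \<open>
  The dimension $d \ge 1$ is the cardinality of an arbitrary finite index type: $\mathbb{R}^d$
  is \<open>real ^ 'd\<close>, $\mathbb{Z}^d$ is \<open>int ^ 'd\<close>, and multi-indices live in \<open>nat ^ 'd\<close>.
\<close>

definition B :: "(real ^ 'd) set" where
  "B = {\<rho>. (\<forall>j. 0 \<le> \<rho> $ j \<and> \<rho> $ j \<le> 1) \<and> (\<Sum>j\<in>UNIV. \<rho> $ j) \<le> 1}"

definition R :: "real ^ 'd \<Rightarrow> real" where
  "R \<rho> = (\<Sum>j\<in>UNIV. \<rho> $ j)"

definition multi_abs :: "nat ^ 'd \<Rightarrow> nat" where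
  "multi_abs \<alpha> = (\<Sum>j\<in>UNIV. \<alpha> $ j)"

definition multi_fact :: "nat ^ 'd \<Rightarrow> nat" where
  "multi_fact \<alpha> = (\<Prod>j\<in>UNIV. fact (\<alpha> $ j))"

definition h :: "nat \<Rightarrow> real ^ 'd \<Rightarrow> real" where
  "h N \<rho> = sqrt (\<Sum>\<alpha> | multi_abs \<alpha> = N.
     1 / (real (multi_fact \<alpha>))\<^sup>2 * (\<Prod>j\<in>UNIV. (\<rho> $ j / 2) ^ (2 * \<alpha> $ j)))"

definition c :: "nat \<Rightarrow> real ^ 'd \<Rightarrow> real" where
  "c N \<rho> = h N \<rho> / ((R \<rho> / 2) ^ N / fact N)"

definition point_mass :: "int ^ 'd \<Rightarrow> int ^ 'd \<Rightarrow> real" where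
  "point_mass x y = (if y = x then 1 else 0)"

definition conv :: "(int ^ 'd \<Rightarrow> real) \<Rightarrow> (int ^ 'd \<Rightarrow> real) \<Rightarrow> int ^ 'd \<Rightarrow> real" where
  "conv f g \<alpha> = (\<Sum>\<^sub>\<infinity>\<beta>\<in>UNIV. f \<beta> * g (\<alpha> - \<beta>))"

primrec conv_power :: "(int ^ 'd \<Rightarrow> real) \<Rightarrow> nat \<Rightarrow> int ^ 'd \<Rightarrow> real" where
  "conv_power f 0 = point_mass 0"
| "conv_power f (Suc N) = conv f (conv_power f N)"

text \<open>
  As an \<open>infsum\<close>, this is $0$ for functions that are not square-summable; it is the
  $\ell^2$-norm on $\ell^2(\mathbb{Z}^d)$, in particular on finitely supported functions.
\<close>

definition l2_norm :: "(int ^ 'd \<Rightarrow> real) \<Rightarrow> real" where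
  "l2_norm f = sqrt (\<Sum>\<^sub>\<infinity>x\<in>UNIV. \<bar>f x\<bar>\<^sup>2)"

text \<open>The standard basis vector $e_j$ of $\mathbb{Z}^d$ is \<open>axis j 1\<close>.\<close>

definition \<nu> :: "real ^ 'd \<Rightarrow> int ^ 'd \<Rightarrow> real" where
  "\<nu> \<rho> x = (\<Sum>j\<in>UNIV. \<rho> $ j / R \<rho> * point_mass (axis j 1) x)"

end

theory Submission
  imports Defs
begin

text \<open>
  Convolution with \<open>\<nu> \<rho>\<close> is one step of a lattice walk with step probabilities
  $p_j = \rho_j / R$, and its $N$-th power is the multinomial distribution, whose \<open>\<ell>\<^sup>2\<close>-norm is
  $c_N$. For the decay, let $M_N$ be the supremum of the walk's distribution after $N$ steps.
  As each step averages, $M_N$ decreases to some $L \ge 0$. A value close to $L$ after $N + K$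
  steps forces the values after $N$ steps at all the points that are reached backwards
  along two directions of positive probability to be close to $L$ too; there are $K + 1$ such
  points, so total mass $1$ gives $(K + 1) L / 2 \le 1$ for every $K$, that is $L = 0$. Finally
  $c_N^2 \le M_N$.
\<close>

section \<open>Decay of the supremum of a lattice walk\<close>

text \<open>Only the one-step recursion is assumed, so the infinite sum in \<open>conv\<close> has
  to be evaluated just once, in \<open>conv_nu\<close>.\<close>

locale lattice_walk =
  fixes p :: "'d::finite \<Rightarrow> real" and g :: "nat \<Rightarrow> int ^ 'd \<Rightarrow> real"
  assumes p_nonneg: "0 \<le> p j"
    and p_sum: "(\<Sum>j\<in>UNIV. p j) = 1"
    and g_0: "g 0 = point_mass 0"
    and g_Suc: "g (Suc N) x = (\<Sum>j\<in>UNIV. p j * g N (x - axis j 1))"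
begin

lemma g_nonneg: "0 \<le> g N x"
  by (induction N arbitrary: x) (auto simp: g_0 g_Suc point_mass_def p_nonneg intro!: sum_nonneg)

text \<open>A step averages the sums of \<open>g N\<close> over translates of \<open>F\<close>.
  Working with finite sets keeps infinite sums out of the argument.\<close>

lemma sum_g_le_1: "finite F \<Longrightarrow> sum (g N) F \<le> 1"
proof (induction N arbitrary: F)
  case 0
  then show ?case by (simp add: g_0 point_mass_def)
next
  case (Suc N)
  have "sum (g (Suc N)) F = (\<Sum>j\<in>UNIV. p j * (\<Sum>x\<in>F. g N (x - axis j 1)))"
    unfolding g_Suc sum_distrib_left by (rule sum.swap)
  also have "\<dots> \<le> (\<Sum>j\<in>UNIV. p j * 1)"
  proof (intro sum_mono mult_left_mono p_nonneg)
    fix j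
    have "(\<Sum>x\<in>F. g N (x - axis j 1)) = sum (g N) ((\<lambda>x. x - axis j 1) ` F)"
      by (simp add: sum.reindex inj_on_def)
    then show "(\<Sum>x\<in>F. g N (x - axis j 1)) \<le> 1"
      using Suc by simp
  qed
  finally show ?case by (simp add: p_sum)
qed

definition M :: "nat \<Rightarrow> real" where
  "M N = (SUP x. g N x)"

lemma bdd_above_g: "bdd_above (range (g N))"
  using sum_g_le_1[of "{x}" N for x] by (auto intro!: bdd_aboveI[of _ 1])

lemma g_le_M: "g N x \<le> M N"
  unfolding M_def by (rule cSUP_upper[OF UNIV_I bdd_above_g])

lemma M_nonneg: "0 \<le> M N"
  using g_nonneg g_le_M order_trans by blast

lemma M_Suc_le: "M (Suc N) \<le> M N"
proof -
  have "g (Suc N) x \<le> M N" for x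
  proof -
    have "g (Suc N) x \<le> (\<Sum>j\<in>UNIV. p j * M N)"
      unfolding g_Suc by (intro sum_mono mult_left_mono g_le_M p_nonneg)
    then show ?thesis by (simp add: p_sum flip: sum_distrib_right)
  qed
  then show ?thesis unfolding M_def[of "Suc N"] by (intro cSUP_least) auto
qed

lemma decseq_M: "decseq M"
  by (rule decseq_SucI) (rule M_Suc_le)

text \<open>A weighted average close to the upper bound of its terms forces every term of positive
  weight to be close to it: bounding all other terms by \<open>L + \<delta>\<close> leaves a deficit
  of at most \<open>(2 / p a - 1) * \<delta>\<close> in direction \<open>a\<close>. The lower bound
  \<open>s\<close> makes the constant independent of the direction.\<close>

lemma step_back:
  assumes "M N \<le> L + \<delta>" "L - \<delta> \<le> g (Suc N) x" "0 < s" "s \<le> p a" "0 \<le> \<delta>"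
  shows "L - 2 / s * \<delta> \<le> g N (x - axis a 1)"
proof -
  have "g (Suc N) x = p a * g N (x - axis a 1) + (\<Sum>j\<in>UNIV - {a}. p j * g N (x - axis j 1))"
    unfolding g_Suc by (subst sum.remove[of _ a]) auto
  also have "(\<Sum>j\<in>UNIV - {a}. p j * g N (x - axis j 1)) \<le> (\<Sum>j\<in>UNIV - {a}. p j * (L + \<delta>))"
    using assms(1) g_le_M order_trans by (intro sum_mono mult_left_mono p_nonneg) blast
  also have "\<dots> = (1 - p a) * (L + \<delta>)"
    by (simp add: sum_diff1 p_sum flip: sum_distrib_right)
  finally have "p a * (L - g N (x - axis a 1)) \<le> p a * (2 / p a * \<delta> - \<delta>)"
    using assms by (simp add: algebra_simps)
  then have "L - g N (x - axis a 1) \<le> 2 / p a * \<delta> - \<delta>"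
    using assms by (simp only: mult_le_cancel_left_pos)
  moreover have "2 / p a * \<delta> \<le> 2 / s * \<delta>"
    using assms by (intro mult_right_mono divide_left_mono) auto
  ultimately show ?thesis using assms(5) by linarith
qed

text \<open>Each application of \<open>step_back\<close> multiplies the error by
  \<open>2 / s\<close>. Bounding \<open>M\<close> at time \<open>N\<close> suffices for all later
  times, as \<open>M\<close> is decreasing.\<close>

lemma steps_back:
  assumes "M N \<le> L + \<delta>" "L - \<delta> \<le> g (N + K) x" "0 < s" "s \<le> p a" "s \<le> p b" "0 \<le> \<delta>" "i \<le> K"
  shows "L - (2 / s) ^ K * \<delta> \<le> g N (x - of_nat i * axis a 1 - of_nat (K - i) * axis b 1)"
  using assms
proof (induction K arbitrary: x i \<delta>)
  case 0
  then show ?case by simp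
next
  case (Suc K)
  have "s \<le> 1"
    using Suc.prems(4) member_le_sum[of a UNIV p] p_nonneg p_sum by simp
  \<comment> \<open>The induction hypothesis is used with the larger error
    \<open>2 / s * \<delta>\<close>, for which the bound on \<open>M N\<close> must still
    hold.\<close>
  then have "1 \<le> 2 / s" using Suc.prems(3) by (simp add: field_simps)
  then have \<delta>: "\<delta> \<le> 2 / s * \<delta>"
    using Suc.prems(6) mult_right_mono[of 1 "2 / s" \<delta>] by simp
  have MN: "M N \<le> L + 2 / s * \<delta>" using Suc.prems(1) \<delta> by linarith
  have M: "M (N + K) \<le> L + \<delta>"
    using decseqD[OF decseq_M, of N "N + K"] Suc.prems(1) by simp
  have pred: "L - 2 / s * \<delta> \<le> g (N + K) (x - axis k 1)" if "s \<le> p k" for k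
    using step_back[OF M _ Suc.prems(3) that Suc.prems(6)] Suc.prems(2) by simp
  note IH = Suc.IH[OF MN pred Suc.prems(3-5)]
  show ?case
  \<comment> \<open>If \<open>i \<le> K\<close>, some step goes along \<open>b\<close> and is taken
    first; otherwise all \<open>Suc K\<close> steps go along \<open>a\<close>.\<close>
  proof (cases "i \<le> K")
    case True
    have "L - (2 / s) ^ K * (2 / s * \<delta>)
        \<le> g N (x - axis b 1 - of_nat i * axis a 1 - of_nat (K - i) * axis b 1)"
      using IH[OF Suc.prems(5) _ True] \<delta> Suc.prems(6) by simp
    also have "x - axis b 1 - of_nat i * axis a 1 - of_nat (K - i) * axis b 1 =
        x - of_nat i * axis a 1 - of_nat (Suc K - i) * axis b 1"
      using True by (simp add: Suc_diff_le algebra_simps)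
    finally show ?thesis by (simp add: mult_ac)
  next
    case False
    then have i: "i = Suc K" using Suc.prems(7) by simp
    have "L - (2 / s) ^ K * (2 / s * \<delta>)
        \<le> g N (x - axis a 1 - of_nat K * axis a 1 - of_nat (K - K) * axis b 1)"
      using IH[OF Suc.prems(4) _ order_refl] \<delta> Suc.prems(6) by simp
    then show ?thesis by (simp add: i algebra_simps)
  qed
qed

lemma M_tendsto_0:
  assumes "a \<noteq> b" "0 < p a" "0 < p b"
  shows "M \<longlonglongrightarrow> 0"
proof -
  obtain L where L: "M \<longlonglongrightarrow> L" "\<And>N. L \<le> M N"
    using decseq_convergent[OF decseq_M, of 0] M_nonneg by blast
  have "0 \<le> L" using L(1) M_nonneg by (intro LIMSEQ_le_const) auto
  define s where "s = min (p a) (p b)"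
  have s: "0 < s" "s \<le> p a" "s \<le> p b" using assms by (auto simp: s_def)
  have bound: "real (Suc K) * (L / 2) \<le> 1" if "0 < L" for K
  proof -
    \<comment> \<open>Chosen so that a value above \<open>L - \<delta>\<close> still leaves at least
      \<open>L / 2\<close> after \<open>K\<close> backward steps. It depends on \<open>K\<close>,
      and \<open>N\<close> is picked only afterwards.\<close>
    define \<delta> where "\<delta> = L / (2 * (2 / s) ^ K)"
    have \<delta>: "0 < \<delta>" "(2 / s) ^ K * \<delta> = L / 2"
      using s that by (auto simp: \<delta>_def)
    from order_tendstoD(2)[OF L(1), of "L + \<delta>"] \<delta> obtain N where N: "M N < L + \<delta>"
      by (auto simp: eventually_sequentially)
    have "L - \<delta> < (SUP x. g (N + K) x)"
      using L(2)[of "N + K"] \<delta> by (simp add: M_def)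
    then obtain x where x: "L - \<delta> < g (N + K) x"
      using less_cSUP_iff[OF UNIV_not_empty bdd_above_g] by blast
    define y where "y i = x - of_nat i * axis a 1 - of_nat (K - i) * axis b 1" for i
    \<comment> \<open>Since \<open>a \<noteq> b\<close>, the coordinate at \<open>a\<close> records
      the number of steps along \<open>a\<close>, so the points \<open>y i\<close> are
      distinct.\<close>
    have ya: "y i $ a = x $ a - int i" for i
      using assms(1) by (simp add: y_def axis_def of_nat_index)
    have "inj_on y {..K}"
      by (rule inj_onI) (metis ya diff_left_imp_eq of_nat_eq_iff add_diff_cancel_left' diff_diff_eq2 diff_add_cancel)
    have "real (Suc K) * (L / 2) = (\<Sum>i\<le>K. L / 2)" by simp
    also have "\<dots> \<le> (\<Sum>i\<le>K. g N (y i))"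
      using steps_back[OF _ _ s, of N L \<delta> K x] N x \<delta>
      by (intro sum_mono) (auto simp: y_def)
    also have "\<dots> = sum (g N) (y ` {..K})"
      using \<open>inj_on y {..K}\<close> by (simp add: sum.reindex)
    also have "\<dots> \<le> 1" by (intro sum_g_le_1) simp
    finally show ?thesis .
  qed
  have "L = 0"
  proof (rule ccontr)
    assume "L \<noteq> 0"
    then have "0 < L / 2" using \<open>0 \<le> L\<close> by simp
    then obtain K where "1 < real K * (L / 2)" using reals_Archimedean3 by blast
    also have "\<dots> \<le> real (Suc K) * (L / 2)" using \<open>0 < L / 2\<close> by (intro mult_right_mono) auto
    finally show False using bound[of K] \<open>0 < L / 2\<close> by simp
  qed
  with L show ?thesis by simp
qed

text \<open>One factor of the square is at most \<open>M N\<close>; the other has total mass at most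
  1.\<close>

lemma infsum_square_le_M: "(\<Sum>\<^sub>\<infinity>x. \<bar>g N x\<bar>\<^sup>2) \<le> M N"
proof -
  have le: "(\<Sum>x\<in>F. \<bar>g N x\<bar>\<^sup>2) \<le> M N" if "finite F" for F
  proof -
    have "(\<Sum>x\<in>F. \<bar>g N x\<bar>\<^sup>2) \<le> (\<Sum>x\<in>F. M N * g N x)"
      by (intro sum_mono) (simp add: power2_eq_square mult_right_mono g_le_M g_nonneg)
    also have "\<dots> \<le> M N * 1"
      unfolding sum_distrib_left[symmetric]
      by (intro mult_left_mono sum_g_le_1 M_nonneg that)
    finally show ?thesis by simp
  qed
  \<comment> \<open>Bounded finite sums also give summability, so the \<open>infsum\<close> is a
    genuine sum and not the default value 0.\<close>
  then have "(\<lambda>x. \<bar>g N x\<bar>\<^sup>2) summable_on UNIV"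
    by (intro nonneg_bdd_above_summable_on) (auto intro!: bdd_aboveI)
  then show ?thesis
    using le by (intro infsum_le_finite_sums)
qed

lemma l2_norm_tendsto_0:
  assumes "a \<noteq> b" "0 < p a" "0 < p b"
  shows "(\<lambda>N. l2_norm (g N)) \<longlonglongrightarrow> 0"
proof (rule tendsto_sandwich[of "\<lambda>_. 0" _ _ "\<lambda>N. sqrt (M N)"])
  show "(\<lambda>N. sqrt (M N)) \<longlonglongrightarrow> 0"
    using tendsto_real_sqrt[OF M_tendsto_0[OF assms]] by simp
qed (use infsum_square_le_M in \<open>auto simp: l2_norm_def intro!: always_eventually infsum_nonneg\<close>)

section \<open>Multinomial formula for the distribution of the walk\<close>

text \<open>
  The extension of $q^k / k!$ by $0$ to negative $k$: then \<open>pow_fact_step\<close> holds for all integers,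
  so the multinomial recursion needs no case distinction at the boundary of the simplex.
\<close>

definition pow_fact :: "real \<Rightarrow> int \<Rightarrow> real" where
  "pow_fact q k = (if k < 0 then 0 else q ^ nat k / fact (nat k))"

lemma pow_fact_step: "q * pow_fact q (k - 1) = of_int k * pow_fact q k"
proof (cases "k \<le> 0")
  \<comment> \<open>At \<open>k = 0\<close> the right side vanishes through its factor
    \<open>k\<close>, the left side through the negative argument.\<close>
  case True
  then show ?thesis by (cases "k = 0") (auto simp: pow_fact_def)
next
  case False
  then obtain n where k: "k = int (Suc n)"
    by (metis not_le zero_less_imp_eq_int gr0_implies_Suc)
  have "q * (q ^ n / fact n) = real (Suc n) * (q ^ Suc n / fact (Suc n))"
    unfolding fact_Suc by (simp del: of_nat_Suc)
  then show ?thesis by (simp add: k pow_fact_def nat_add_distrib)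
qed

text \<open>By \<open>pow_fact_step\<close>, each term of the recursion is \<open>x $ j\<close>
  times one common product; the coordinates add up to \<open>Suc N\<close>, which turns
  \<open>fact N\<close> into \<open>fact (Suc N)\<close>.\<close>

lemma g_eq_multinomial:
  "g N x = (if (\<Sum>j\<in>UNIV. x $ j) = int N then fact N * (\<Prod>j\<in>UNIV. pow_fact (p j) (x $ j)) else 0)"
proof (induction N arbitrary: x)
  case 0
  show ?case
  proof (cases "x = 0")
    case True
    then show ?thesis by (simp add: g_0 point_mass_def pow_fact_def)
  next
    case False
    \<comment> \<open>A nonzero \<open>x\<close> with coordinate sum 0 has a negative coordinate,
      where \<open>pow_fact\<close> vanishes.\<close>
    moreover have "\<exists>j. x $ j < 0" if "(\<Sum>j\<in>UNIV. x $ j) = 0"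
    proof (rule ccontr)
      assume "\<nexists>j. x $ j < 0"
      then have "\<forall>j. x $ j = 0"
        using that sum_nonneg_eq_0_iff[of UNIV "\<lambda>j. x $ j"] by (auto simp: not_less)
      then show False using False by (simp add: vec_eq_iff)
    qed
    ultimately show ?thesis
      by (auto simp: g_0 point_mass_def pow_fact_def)
  qed
next
  case (Suc N)
  \<comment> \<open>All predecessors of \<open>x\<close> lie one level lower, so off level
    \<open>Suc N\<close> every term is 0.\<close>
  have sum: "(\<Sum>i\<in>UNIV. (x - axis j 1) $ i) = (\<Sum>i\<in>UNIV. x $ i) - 1" for j
    by (simp add: sum_subtractf axis_def)
  have prod: "p j * (\<Prod>i\<in>UNIV. pow_fact (p i) ((x - axis j 1) $ i)) =
      of_int (x $ j) * (\<Prod>i\<in>UNIV. pow_fact (p i) (x $ i))" for j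
  proof -
    have "(\<Prod>i\<in>UNIV - {j}. pow_fact (p i) ((x - axis j 1) $ i)) =
        (\<Prod>i\<in>UNIV - {j}. pow_fact (p i) (x $ i))"
      by (intro prod.cong) (auto simp: axis_def)
    then show ?thesis
      using pow_fact_step[of "p j" "x $ j"]
      by (subst (1 2) prod.remove[of UNIV j]) (auto simp: axis_def)
  qed
  show ?case
  proof (cases "(\<Sum>i\<in>UNIV. x $ i) = int (Suc N)")
    case True
    have "g (Suc N) x =
        (\<Sum>j\<in>UNIV. fact N * (p j * (\<Prod>i\<in>UNIV. pow_fact (p i) ((x - axis j 1) $ i))))"
      unfolding g_Suc Suc.IH sum using True by (simp add: mult_ac)
    also have "\<dots> = fact N * of_int (\<Sum>j\<in>UNIV. x $ j) * (\<Prod>i\<in>UNIV. pow_fact (p i) (x $ i))"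
      unfolding prod by (simp add: sum_distrib_left sum_distrib_right mult_ac)
    finally show ?thesis using True by (simp add: mult_ac)
  next
    case False
    then show ?thesis unfolding g_Suc Suc.IH sum by auto
  qed
qed

text \<open>\<open>g N\<close> vanishes wherever a coordinate is negative, so its support lies in
  the embedded multi-indices of order \<open>N\<close>.\<close>

lemma infsum_square:
  "(\<Sum>\<^sub>\<infinity>x. \<bar>g N x\<bar>\<^sup>2) = (\<Sum>\<alpha> | multi_abs \<alpha> = N.
     (fact N / real (multi_fact \<alpha>) * (\<Prod>j\<in>UNIV. p j ^ (\<alpha> $ j)))\<^sup>2)"
proof -
  define emb :: "nat ^ 'd \<Rightarrow> int ^ 'd" where "emb \<alpha> = (\<chi> j. int (\<alpha> $ j))" for \<alpha>
  have sum_emb: "(\<Sum>j\<in>UNIV. emb \<alpha> $ j) = int (multi_abs \<alpha>)" for \<alpha>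
    by (simp add: emb_def multi_abs_def)
  have g_emb: "g N (emb \<alpha>) = fact N / real (multi_fact \<alpha>) * (\<Prod>j\<in>UNIV. p j ^ (\<alpha> $ j))"
    if "multi_abs \<alpha> = N" for \<alpha>
    using that by (simp add: g_eq_multinomial sum_emb)
      (simp add: emb_def pow_fact_def multi_fact_def prod_dividef)
  have inj: "inj emb" by (auto simp: inj_def emb_def vec_eq_iff)
  have supp: "x \<in> emb ` {\<alpha>. multi_abs \<alpha> = N}" if "g N x \<noteq> 0" for x
  proof -
    have "\<forall>j. 0 \<le> x $ j" and sum: "(\<Sum>j\<in>UNIV. x $ j) = int N"
      using that by (auto simp: g_eq_multinomial pow_fact_def not_less[symmetric] split: if_splits)
    then have "x = emb (\<chi> j. nat (x $ j))" by (simp add: emb_def vec_eq_iff)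
    then show ?thesis using sum sum_emb by (metis (mono_tags) of_nat_eq_iff image_eqI mem_Collect_eq)
  qed
  \<comment> \<open>Finiteness turns the \<open>infsum\<close> over the image of \<open>emb\<close>
    into an ordinary sum.\<close>
  have fin: "finite {\<alpha> :: nat ^ 'd. multi_abs \<alpha> = N}"
  proof (rule finite_subset)
    show "{\<alpha> :: nat ^ 'd. multi_abs \<alpha> = N} \<subseteq> vec_lambda ` (UNIV \<rightarrow>\<^sub>E {..N})"
    proof
      fix \<alpha> :: "nat ^ 'd" assume "\<alpha> \<in> {\<alpha>. multi_abs \<alpha> = N}"
      then have "\<alpha> $ j \<le> N" for j
        using member_le_sum[of j UNIV "\<lambda>j. \<alpha> $ j"] by (simp add: multi_abs_def)
      then show "\<alpha> \<in> vec_lambda ` (UNIV \<rightarrow>\<^sub>E {..N})"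
        by (intro image_eqI[of _ _ "vec_nth \<alpha>"]) auto
    qed
    show "finite (vec_lambda ` (UNIV \<rightarrow>\<^sub>E {..N}) :: (nat ^ 'd) set)"
      by (intro finite_imageI finite_PiE) auto
  qed
  have "(\<Sum>\<^sub>\<infinity>x. \<bar>g N x\<bar>\<^sup>2) = (\<Sum>\<^sub>\<infinity>x\<in>emb ` {\<alpha>. multi_abs \<alpha> = N}. \<bar>g N x\<bar>\<^sup>2)"
    by (intro infsum_cong_neutral) (use supp in auto)
  also have "\<dots> = (\<Sum>\<alpha> | multi_abs \<alpha> = N. \<bar>g N (emb \<alpha>)\<bar>\<^sup>2)"
    using fin inj by (simp add: sum.reindex inj_on_subset)
  also have "\<dots> = (\<Sum>\<alpha> | multi_abs \<alpha> = N.
     (fact N / real (multi_fact \<alpha>) * (\<Prod>j\<in>UNIV. p j ^ (\<alpha> $ j)))\<^sup>2)"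
    by (intro sum.cong) (simp_all only: g_emb power2_abs mem_Collect_eq)
  finally show ?thesis .
qed

end

section \<open>Convolution with \<open>\<nu> \<rho>\<close> as a lattice walk, and the identity for
  \<open>c\<close>\<close>

lemma nu_eq_0: "x \<notin> range (\<lambda>j. axis j 1) \<Longrightarrow> \<nu> \<rho> x = 0"
  by (auto simp: \<nu>_def point_mass_def intro!: sum.neutral)

text \<open>The support of \<open>\<nu> \<rho>\<close> lies in the basis vectors, so the sum is
  finite. Expanding into point masses and swapping sums avoids evaluating
  \<open>\<nu> \<rho>\<close> at a basis vector.\<close>

lemma conv_nu: "conv (\<nu> \<rho>) f x = (\<Sum>j\<in>UNIV. \<rho> $ j / R \<rho> * f (x - axis j 1))"
proof -
  let ?A = "range (\<lambda>j. axis j 1) :: (int ^ 'a) set"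
  have "conv (\<nu> \<rho>) f x = (\<Sum>\<^sub>\<infinity>\<beta>\<in>?A. \<nu> \<rho> \<beta> * f (x - \<beta>))"
    unfolding conv_def by (intro infsum_cong_neutral) (auto simp: nu_eq_0)
  also have "\<dots> = (\<Sum>\<beta>\<in>?A. \<Sum>j\<in>UNIV. \<rho> $ j / R \<rho> * (point_mass (axis j 1) \<beta> * f (x - \<beta>)))"
    by (simp only: \<nu>_def sum_distrib_right mult.assoc infsum_finite finite_imageI finite)
  also have "\<dots> = (\<Sum>j\<in>UNIV. \<rho> $ j / R \<rho> * (\<Sum>\<beta>\<in>?A. point_mass (axis j 1) \<beta> * f (x - \<beta>)))"
    unfolding sum_distrib_left by (rule sum.swap)
  also have "\<dots> = (\<Sum>j\<in>UNIV. \<rho> $ j / R \<rho> * f (x - axis j 1))"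
    by (simp add: point_mass_def if_distrib[of "\<lambda>t. t * _"] cong: if_cong)
  finally show ?thesis .
qed

lemma R_pos:
  assumes "\<rho> \<in> B - {0}"
  shows "0 < R \<rho>"
proof -
  have nonneg: "0 \<le> \<rho> $ j" for j using assms by (simp add: B_def)
  moreover obtain j where "\<rho> $ j \<noteq> 0" using assms by (auto simp: vec_eq_iff)
  ultimately have "0 < \<rho> $ j" by (simp add: less_le)
  also have "\<dots> \<le> R \<rho>" unfolding R_def using nonneg by (intro member_le_sum) auto
  finally show ?thesis .
qed

lemma lattice_walk_nu:
  assumes "\<rho> \<in> B - {0}"
  shows "lattice_walk (\<lambda>j. \<rho> $ j / R \<rho>) (conv_power (\<nu> \<rho>))"
proof
  show "0 \<le> \<rho> $ j / R \<rho>" for j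
    using assms R_pos[OF assms] by (simp add: B_def)
  show "(\<Sum>j\<in>UNIV. \<rho> $ j / R \<rho>) = 1"
    using R_pos[OF assms] by (simp add: R_def flip: sum_divide_distrib)
qed (simp_all add: conv_nu)

text \<open>For a multi-index of order \<open>N\<close>, the power \<open>(R \<rho> / 2) ^ N\<close>
  splits over the coordinates and turns \<open>\<rho> $ j / 2\<close> into
  \<open>\<rho> $ j / R \<rho>\<close>, while \<open>fact N\<close> completes the multinomial
  coefficient. The two sums then agree term by term.\<close>

lemma c_eq_l2_norm:
  assumes "\<rho> \<in> B - {0}"
  shows "c N \<rho> = l2_norm (conv_power (\<nu> \<rho>) N)"
proof -
  interpret lattice_walk "\<lambda>j. \<rho> $ j / R \<rho>" "conv_power (\<nu> \<rho>)"
    by (rule lattice_walk_nu[OF assms])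
  let ?C = "(R \<rho> / 2) ^ N / fact N"
  have C: "0 < ?C" using R_pos[OF assms] by simp
  have summand: "1 / (real (multi_fact \<alpha>))\<^sup>2 * (\<Prod>j\<in>UNIV. (\<rho> $ j / 2) ^ (2 * \<alpha> $ j)) / ?C\<^sup>2 =
      (fact N / real (multi_fact \<alpha>) * (\<Prod>j\<in>UNIV. (\<rho> $ j / R \<rho>) ^ (\<alpha> $ j)))\<^sup>2"
    if "multi_abs \<alpha> = N" for \<alpha>
  proof -
    have R: "(\<Prod>j\<in>UNIV. (R \<rho> / 2) ^ (\<alpha> $ j)) = (R \<rho> / 2) ^ N"
      using that by (simp add: multi_abs_def flip: power_sum)
    have "(\<Prod>j\<in>UNIV. (\<rho> $ j / 2) ^ (\<alpha> $ j)) =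
        (\<Prod>j\<in>UNIV. (\<rho> $ j / R \<rho>) ^ (\<alpha> $ j) * (R \<rho> / 2) ^ (\<alpha> $ j))"
      using R_pos[OF assms] by (intro prod.cong) (simp_all flip: power_mult_distrib)
    also have "\<dots> = (\<Prod>j\<in>UNIV. (\<rho> $ j / R \<rho>) ^ (\<alpha> $ j)) * (R \<rho> / 2) ^ N"
      by (simp only: prod.distrib R)
    finally have eq: "(\<Prod>j\<in>UNIV. (\<rho> $ j / 2) ^ (\<alpha> $ j)) =
        (\<Prod>j\<in>UNIV. (\<rho> $ j / R \<rho>) ^ (\<alpha> $ j)) * (R \<rho> / 2) ^ N" .
    have "(\<Prod>j\<in>UNIV. (\<rho> $ j / 2) ^ (2 * \<alpha> $ j)) = (\<Prod>j\<in>UNIV. (\<rho> $ j / 2) ^ (\<alpha> $ j))\<^sup>2"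
      by (simp only: power_even_eq prod_power_distrib)
    then show ?thesis
      unfolding eq using R_pos[OF assms] by (simp add: power_mult_distrib power_divide)
  qed
  \<comment> \<open>Being positive, \<open>?C\<close> is the root of its square and can be moved
    under the root.\<close>
  have "c N \<rho> = sqrt ((\<Sum>\<alpha> | multi_abs \<alpha> = N.
      1 / (real (multi_fact \<alpha>))\<^sup>2 * (\<Prod>j\<in>UNIV. (\<rho> $ j / 2) ^ (2 * \<alpha> $ j))) / ?C\<^sup>2)"
    by (simp only: c_def h_def real_sqrt_divide real_sqrt_abs abs_of_pos[OF C])
  also have "\<dots> = l2_norm (conv_power (\<nu> \<rho>) N)"
    unfolding l2_norm_def infsum_square sum_divide_distrib using summand
    by (intro arg_cong[of _ _ sqrt] sum.cong) auto
  finally show ?thesis .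
qed

theorem proposition3p10:
  fixes \<rho> :: "real ^ 'd"
  assumes "\<rho> \<in> B - {0}"
  shows "finite {x. \<nu> \<rho> x \<noteq> 0}
    \<and> (\<forall>N. c N \<rho> = l2_norm (conv_power (\<nu> \<rho>) N))
    \<and> (card {j. 0 < \<rho> $ j} \<ge> 2 \<longrightarrow> (\<lambda>N. c N \<rho>) \<longlonglongrightarrow> 0)"
proof (intro conjI allI impI)
  show "finite {x. \<nu> \<rho> x \<noteq> 0}"
    by (rule finite_subset[of _ "range (\<lambda>j. axis j 1)"]) (use nu_eq_0 in auto)
  show "c N \<rho> = l2_norm (conv_power (\<nu> \<rho>) N)" for N
    by (rule c_eq_l2_norm[OF assms])
  assume "card {j. 0 < \<rho> $ j} \<ge> 2"
  then obtain a b where "a \<noteq> b" "0 < \<rho> $ a" "0 < \<rho> $ b"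
    using card_le_Suc0_iff_eq[of "{j. 0 < \<rho> $ j}"] by fastforce
  then show "(\<lambda>N. c N \<rho>) \<longlonglongrightarrow> 0"
    using lattice_walk.l2_norm_tendsto_0[OF lattice_walk_nu[OF assms], of a b] R_pos[OF assms]
    by (simp add: c_eq_l2_norm[OF assms])
qed

end
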